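(* Let $\mathcal{V} = \{1, 2, 2^2, 2^3, \dots\} \cup \{-1, -2, -2^2, -2^3, \dots\} \subseteq \mathbb{Z}$. Then there exists an infinite subset $\mathcal{U}$ of $\mathbb{Z}_{\leq -1} = \{n \in \mathbb{Z} \mid n \leq -1\}$ such that $(\mathcal{U}, \mathcal{V})$ is a co-minimal pair in $\mathbb{Z}$.
   Context: For nonempty subsets $A, B$ of an abelian group $(G,+)$, write $A + B = \{a+b \mid a\in A, b\in B\}$. The pair $(A,B)$ is called a co-minimal pair in $G$ if $A + B = G$, $A' + B \subsetneq G$ for every $\emptyset \neq A' \subsetneq A$, and $A + B' \subsetneq G$ for every $\emptyset \neq B' \subsetneq B$. *)

theory Defs
  imports Main "HOL-Library.Set_Algebras"
begin

(* The ambient abelian group is the whole type, so the carrier G is UNIV.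
   The sum A + B of two sets is the Minkowski sum of Set_Algebras. *)
definition co_minimal_pair :: "'a::ab_group_add set \<Rightarrow> 'a set \<Rightarrow> bool" where
  "co_minimal_pair A B \<longleftrightarrow>
     A \<noteq> {} \<and> B \<noteq> {} \<and> A + B = UNIV \<and>
     (\<forall>A'. A' \<noteq> {} \<and> A' \<subset> A \<longrightarrow> A' + B \<subset> UNIV) \<and>
     (\<forall>B'. B' \<noteq> {} \<and> B' \<subset> B \<longrightarrow> A + B' \<subset> UNIV)"

end

theory Submission
  imports Defs "HOL-Library.Countable"
begin

text \<open>
  Two distinct translates of \<^term>\<open>V\<close> meet in a finite set only, because a nonzero integer is a
  difference of two elements \<open>\<plusminus>2\<^sup>k\<close> in finitely many ways, while every translate contains
  infinitely many negative integers.  This makes a greedy construction possible.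

  Build \<open>U\<close> one element at a time, each new element \<open>u\<close> together with a witness \<open>y \<in> u + V\<close>, in
  such a way that no other element of \<open>U\<close>, chosen earlier or later, represents \<open>y\<close> in \<open>U + V\<close>.
  The only representation \<open>y = u + v\<close> then shows at once that \<open>u\<close> cannot be left out of \<open>U\<close> and
  that \<open>v\<close> cannot be left out of \<open>V\<close>.  So it remains to ensure in countably many stages that every
  integer gets represented and that every \<open>v \<in> V\<close> arises as some \<open>y - u\<close>.

  The first is possible because an integer \<open>x\<close> not yet represented is not one of the finitely many
  witnesses; hence all but finitely many elements of \<open>x - V\<close> lie outside the sets \<open>y - V\<close> that the
  witnesses \<open>y\<close> forbid, and \<open>x\<close> may serve as the witness of the new element
  (\<open>separated_extend_cover\<close>).  For the second, \<open>u\<close> has to avoid finitely many translates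
  of \<open>V\<close>, and an element of a further translate does so (\<open>separated_extend_difference\<close>).
  The argument works for any symmetric set with these two properties in any countable abelian
  group.
\<close>

section \<open>Sparse symmetric sets in countable abelian groups\<close>

text \<open>
  The set \<open>N\<close> is where the partner of \<open>V\<close> is sought.  The third assumption says that distinct
  translates of \<open>V\<close> are almost disjoint.
\<close>

locale sparse_symmetric =
  fixes V N :: "'a::{ab_group_add, countable} set"
  assumes symmetric: "v \<in> V \<Longrightarrow> - v \<in> V"
    and infinite_translate: "infinite {u \<in> N. x - u \<in> V}"
    and sparse: "c \<noteq> 0 \<Longrightarrow> finite {v \<in> V. v + c \<in> V}"
begin

lemma finite_translate_Int:
  assumes "a \<noteq> b"
  shows "finite {u. a - u \<in> V \<and> b - u \<in> V}"
proof (rule finite_subset)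
  show "{u. a - u \<in> V \<and> b - u \<in> V} \<subseteq> (\<lambda>v. a - v) ` {v \<in> V. v + (b - a) \<in> V}"
  proof
    fix u assume "u \<in> {u. a - u \<in> V \<and> b - u \<in> V}"
    then have "a - u \<in> {v \<in> V. v + (b - a) \<in> V}" "u = a - (a - u)"
      by (simp_all add: algebra_simps)
    then show "u \<in> (\<lambda>v. a - v) ` {v \<in> V. v + (b - a) \<in> V}" by blast
  qed
  show "finite ((\<lambda>v. a - v) ` {v \<in> V. v + (b - a) \<in> V})"
    using assms by (intro finite_imageI sparse) simp
qed

lemma translate_avoids_finitely_many:
  assumes "finite S" "x \<notin> S"
  obtains u where "u \<in> N" "x - u \<in> V" "\<And>s. s \<in> S \<Longrightarrow> s - u \<notin> V"
proof -
  have "finite (\<Union>s\<in>S. {u. x - u \<in> V \<and> s - u \<in> V})"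
    using assms by (intro finite_UN_I finite_translate_Int) auto
  with infinite_translate[of x]
  have "\<not> {u \<in> N. x - u \<in> V} \<subseteq> (\<Union>s\<in>S. {u. x - u \<in> V \<and> s - u \<in> V})"
    using finite_subset by blast
  then show thesis using that by blast
qed

lemma infinite_group: "infinite (UNIV :: 'a set)"
  using infinite_translate[of 0] finite_subset[OF subset_UNIV] by blast


section \<open>Systems of elements with private witnesses\<close>

text \<open>
  A pair \<open>(y, u)\<close> records an element \<open>u\<close> of the set under construction and a witness \<open>y\<close>, which
  \<open>u\<close> and no other recorded element represents modulo \<open>V\<close>.
\<close>

definition separated :: "('a \<times> 'a) set \<Rightarrow> bool" where
  "separated P \<longleftrightarrow>
     (\<forall>(y, u) \<in> P. u \<in> N \<and> y - u \<in> V) \<and>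
     (\<forall>(y, u) \<in> P. \<forall>(z, w) \<in> P. y - w \<in> V \<longrightarrow> w = u)"

lemma separated_insert:
  assumes "separated P" "u \<in> N" "y - u \<in> V"
    and "\<And>z w. (z, w) \<in> P \<Longrightarrow> y - w \<notin> V \<and> z - u \<notin> V"
  shows "separated (insert (y, u) P)"
  using assms unfolding separated_def by fast

text \<open>
  If \<open>x\<close> is not represented yet, it differs from all witnesses used so far, so almost every
  element of \<open>x - V\<close> respects them; and \<open>x\<close> itself is the witness of the element chosen.
\<close>

lemma separated_extend_cover:
  assumes "finite P" "separated P"
  obtains P' where "P \<subseteq> P'" "finite P'" "separated P'" "\<exists>(y, u) \<in> P'. x - u \<in> V"
proof (cases "\<exists>(y, u) \<in> P. x - u \<in> V")
  case True
  then show thesis using that assms by blast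
next
  case False
  then have "x \<notin> fst ` P"
    using assms(2) unfolding separated_def by fastforce
  moreover have "finite (fst ` P)" using assms(1) by simp
  ultimately obtain u where u: "u \<in> N" "x - u \<in> V" "\<And>s. s \<in> fst ` P \<Longrightarrow> s - u \<notin> V"
    using translate_avoids_finitely_many[of "fst ` P" x] by metis
  have "separated (insert (x, u) P)"
    using assms(2) u False by (intro separated_insert) force+
  then show thesis using that[of "insert (x, u) P"] u(2) assms(1) by auto
qed

text \<open>
  The new pair has the form \<open>(u + v, u)\<close>.  By symmetry, \<open>u + v\<close> is not represented by a recorded
  \<open>w\<close> if and only if \<open>(w - v) - u\<close> is not in \<open>V\<close>; so both conditions on \<open>u\<close> say that \<open>u\<close> avoids
  certain translates of \<open>V\<close>, finite in number.
\<close>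

lemma separated_extend_difference:
  assumes "finite P" "separated P" "v \<in> V"
  obtains P' where "P \<subseteq> P'" "finite P'" "separated P'" "\<exists>(y, u) \<in> P'. y - u = v"
proof -
  let ?S = "fst ` P \<union> (\<lambda>w. w - v) ` snd ` P"
  have "finite ?S" using assms(1) by simp
  with infinite_group obtain t where "t \<notin> ?S"
    using ex_new_if_finite by blast
  with \<open>finite ?S\<close> obtain u where u: "u \<in> N" "t - u \<in> V" "\<And>s. s \<in> ?S \<Longrightarrow> s - u \<notin> V"
    by (rule translate_avoids_finitely_many) (rule that)
  have "u + v - w \<notin> V \<and> z - u \<notin> V" if "(z, w) \<in> P" for z w
  proof
    have "w - v \<in> ?S" using that by force
    then have "w - v - u \<notin> V" by (rule u(3))
    moreover have "- (u + v - w) = w - v - u" by (simp add: algebra_simps)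
    ultimately show "u + v - w \<notin> V" using symmetric[of "u + v - w"] by metis
    have "z \<in> ?S" using that by force
    then show "z - u \<notin> V" by (rule u(3))
  qed
  then have "separated (insert (u + v, u) P)"
    using assms u(1) by (intro separated_insert) auto
  then show thesis using that[of "insert (u + v, u) P"] assms(1) by auto
qed

lemma separated_extend:
  assumes "finite P" "separated P"
  shows "\<exists>P'. (finite P' \<and> separated P') \<and> (P \<subseteq> P' \<and>
    (\<exists>(y, u) \<in> P'. x - u \<in> V) \<and> (x \<in> V \<longrightarrow> (\<exists>(y, u) \<in> P'. y - u = x)))"
proof -
  obtain Q where Q: "P \<subseteq> Q" "finite Q" "separated Q" "\<exists>(y, u) \<in> Q. x - u \<in> V"
    using separated_extend_cover[OF assms] .
  show ?thesis
  proof (cases "x \<in> V")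
    case True
    obtain R where R: "Q \<subseteq> R" "finite R" "separated R" "\<exists>(y, u) \<in> R. y - u = x"
      using separated_extend_difference[OF Q(2,3) True] .
    have "P \<subseteq> R" using Q(1) R(1) by (rule subset_trans)
    moreover have "\<exists>(y, u) \<in> R. x - u \<in> V" using R(1) Q(4) by (meson subsetD)
    ultimately show ?thesis using R(2-4) by (intro exI[of _ R]) simp
  next
    case False
    then show ?thesis using Q by (intro exI[of _ Q]) simp
  qed
qed

lemma separated_Union_chain:
  assumes "\<And>n. separated (F n)" "\<And>n. F n \<subseteq> F (Suc n)"
  shows "separated (\<Union>n::nat. F n)"
proof -
  have mono: "F m \<subseteq> F n" if "m \<le> n" for m n
    using lift_Suc_mono_le[of F] assms(2) that by blast
  have "w = u" if "(y, u) \<in> F m" "(z, w) \<in> F n" "y - w \<in> V" for y u z w m n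
  proof -
    have "(y, u) \<in> F (max m n)" "(z, w) \<in> F (max m n)"
      using that mono[of m "max m n"] mono[of n "max m n"] by auto
    then show ?thesis using assms(1)[of "max m n"] that(3) unfolding separated_def by blast
  qed
  moreover have "u \<in> N \<and> y - u \<in> V" if "(y, u) \<in> F n" for y u n
    using assms(1)[of n] that unfolding separated_def by blast
  ultimately show ?thesis unfolding separated_def by blast
qed

lemma ex_saturated_separated:
  obtains P where "separated P" "\<And>x. \<exists>(y, u) \<in> P. x - u \<in> V"
    "\<And>v. v \<in> V \<Longrightarrow> \<exists>(y, u) \<in> P. y - u = v"
proof -
  define met :: "'a \<Rightarrow> ('a \<times> 'a) set \<Rightarrow> bool" where
    "met x P \<longleftrightarrow> (\<exists>(y, u) \<in> P. x - u \<in> V) \<and> (x \<in> V \<longrightarrow> (\<exists>(y, u) \<in> P. y - u = x))" for x P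
  \<comment> \<open>Stage \<open>n\<close> serves the group element with number \<open>n\<close>.\<close>
  obtain F where F: "\<And>n. finite (F n) \<and> separated (F n)"
    "\<And>n. F n \<subseteq> F (Suc n) \<and> met (from_nat n) (F (Suc n))"
  proof (rule exE[OF dependent_nat_choice[where P = "\<lambda>_ P. finite P \<and> separated P"
        and Q = "\<lambda>n P P'. P \<subseteq> P' \<and> met (from_nat n) P'"]])
    show "\<exists>P. finite P \<and> separated P"
      by (rule exI[of _ "{}"]) (simp add: separated_def)
    show "\<exists>P'. (finite P' \<and> separated P') \<and> (P \<subseteq> P' \<and> met (from_nat n) P')"
      if P: "finite P \<and> separated P" for P and n
      unfolding met_def using P by (intro separated_extend) simp_all
  qed blast
  have "met x (\<Union>n. F n)" for x
  proof -
    have "met x (F (Suc (to_nat x)))" using F(2)[of "to_nat x"] by simp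
    then show ?thesis unfolding met_def by blast
  qed
  moreover have "separated (\<Union>n. F n)"
    using F by (intro separated_Union_chain) simp_all
  ultimately show thesis
    using that[of "\<Union>n. F n"] unfolding met_def by simp
qed


section \<open>Co-minimal partners\<close>

text \<open>
  Finitely many translates of \<open>V\<close> cannot cover a further one.
\<close>

lemma infinite_if_covers:
  assumes "\<And>x. \<exists>u \<in> U. x - u \<in> V"
  shows "infinite U"
proof
  assume "finite U"
  with infinite_group obtain t where "t \<notin> U"
    using ex_new_if_finite by blast
  with \<open>finite U\<close> obtain x where "t - x \<in> V" "\<And>u. u \<in> U \<Longrightarrow> u - x \<notin> V"
    by (rule translate_avoids_finitely_many) blast
  moreover obtain u where "u \<in> U" "x - u \<in> V" using assms by blast
  ultimately show False using symmetric[of "x - u"] by auto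
qed

theorem ex_co_minimal_partner: "\<exists>U \<subseteq> N. infinite U \<and> co_minimal_pair U V"
proof -
  obtain P where P: "separated P" "\<And>x. \<exists>(y, u) \<in> P. x - u \<in> V"
    "\<And>v. v \<in> V \<Longrightarrow> \<exists>(y, u) \<in> P. y - u = v"
    using ex_saturated_separated by blast
  define U where "U = snd ` P"
  have cover: "\<exists>u \<in> U. x - u \<in> V" for x
    using P(2)[of x] unfolding U_def by force
  have unique: "a = u \<and> b = y - u" if "(y, u) \<in> P" "a \<in> U" "b \<in> V" "y = a + b" for y u a b
  proof -
    have "y - a \<in> V" using that by simp
    then have "a = u"
      using P(1) that(1,2) unfolding separated_def U_def by fastforce
    then show ?thesis using that(4) by simp
  qed
  have "infinite U" using cover by (rule infinite_if_covers)
  moreover have "U \<subseteq> N"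
    using P(1) unfolding separated_def U_def by auto
  moreover have "co_minimal_pair U V"
    unfolding co_minimal_pair_def
  proof (intro conjI allI impI)
    show "U \<noteq> {}" "V \<noteq> {}" using cover[of 0] by auto
    have "x \<in> U + V" for x
    proof -
      obtain u where "u \<in> U" "x - u \<in> V" using cover by blast
      then have "u + (x - u) \<in> U + V" by (rule set_plus_intro)
      then show ?thesis by simp
    qed
    then show "U + V = UNIV" by blast
  next
    fix A assume A: "A \<noteq> {} \<and> A \<subset> U"
    then obtain u where u: "u \<in> U" "u \<notin> A" by blast
    then obtain y where y: "(y, u) \<in> P" unfolding U_def by auto
    have "y \<notin> A + V"
    proof
      assume "y \<in> A + V"
      then obtain a b where "y = a + b" "a \<in> A" "b \<in> V" by (rule set_plus_elim)
      then show False using unique[OF y, of a b] A u(2) by blast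
    qed
    then show "A + V \<subset> UNIV" by blast
  next
    fix B assume B: "B \<noteq> {} \<and> B \<subset> V"
    then obtain v where v: "v \<in> V" "v \<notin> B" by blast
    then obtain y u where y: "(y, u) \<in> P" "y - u = v" using P(3) by blast
    have "y \<notin> U + B"
    proof
      assume "y \<in> U + B"
      then obtain a b where "y = a + b" "a \<in> U" "b \<in> B" by (rule set_plus_elim)
      moreover from this have "b = v" using unique[OF y(1), of a b] B y(2) by auto
      ultimately show False using v(2) by simp
    qed
    then show "U + B \<subset> UNIV" by blast
  qed
  ultimately show ?thesis by blast
qed

end


section \<open>Signed powers of two\<close>

text \<open>
  Of two distinct powers of two the larger is at least twice the smaller, so the difference of
  two signed powers is either \<open>0\<close> or at least half the larger modulus.
\<close>

lemma abs_le_twice_difference: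
  fixes a b :: int
  assumes a: "\<bar>a\<bar> = 2 ^ i" and b: "\<bar>b\<bar> = 2 ^ j" and "a \<noteq> b"
  shows "\<bar>a\<bar> \<le> 2 * \<bar>b - a\<bar>"
proof -
  have double: "2 * 2 ^ m \<le> (2 :: int) ^ n" if "m < n" for m n :: nat
    using power_increasing[of "Suc m" n "2 :: int"] that by simp
  consider "i = j" | "i < j" | "j < i" by linarith
  then show ?thesis
  proof cases
    case 1
    then have "\<bar>a\<bar> = \<bar>b\<bar>" using a b by simp
    then have "a = - b" using \<open>a \<noteq> b\<close> by (simp add: abs_eq_iff)
    then show ?thesis by simp
  next
    case 2
    then have "2 * \<bar>a\<bar> \<le> \<bar>b\<bar>" using a b double[of i j] by simp
    then have "\<bar>a\<bar> \<le> \<bar>b\<bar> - \<bar>a\<bar>" by simp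
    also have "\<dots> \<le> \<bar>b - a\<bar>" by (rule abs_triangle_ineq2)
    also have "\<dots> \<le> 2 * \<bar>b - a\<bar>" using abs_ge_zero[of "b - a"] by simp
    finally show ?thesis .
  next
    case 3
    then have "2 * \<bar>b\<bar> \<le> \<bar>a\<bar>" using a b double[of j i] by simp
    then have "\<bar>a\<bar> \<le> 2 * (\<bar>a\<bar> - \<bar>b\<bar>)" by simp
    also have "\<dots> \<le> 2 * \<bar>b - a\<bar>" using abs_triangle_ineq2_sym[of a b] by simp
    finally show ?thesis .
  qed
qed

theorem theorem1p2:
  fixes V :: "int set"
  assumes "V = {2 ^ n | n :: nat. True} \<union> {- (2 ^ n) | n :: nat. True}"
  shows "\<exists>U :: int set. U \<subseteq> {n. n \<le> - 1} \<and> infinite U \<and> co_minimal_pair U V"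
proof -
  have power: "\<exists>n::nat. \<bar>v\<bar> = 2 ^ n" if "v \<in> V" for v
    using that assms by auto
  interpret sparse_symmetric V "{n. n \<le> - 1}"
  proof
    show "- v \<in> V" if "v \<in> V" for v
      using that assms by auto
  next
    fix x :: int
    \<comment> \<open>The elements \<open>x - 2\<^sup>n\<close> are distinct, and negative as soon as \<open>\<bar>x\<bar> < n\<close>.\<close>
    have "(\<lambda>n. x - 2 ^ n) ` {nat \<bar>x\<bar> <..} \<subseteq> {u \<in> {n. n \<le> - 1}. x - u \<in> V}"
    proof
      fix u assume "u \<in> (\<lambda>n. x - 2 ^ n) ` {nat \<bar>x\<bar> <..}"
      then obtain n where n: "nat \<bar>x\<bar> < n" "u = x - 2 ^ n" by auto
      have "int n < 2 ^ n" using less_exp[of n] by (metis of_nat_less_iff of_nat_numeral of_nat_power)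
      then have "u \<le> - 1" using n by linarith
      then show "u \<in> {u \<in> {n. n \<le> - 1}. x - u \<in> V}" using n(2) assms by auto
    qed
    moreover have "infinite ((\<lambda>n. x - 2 ^ n) ` {nat \<bar>x\<bar> <..})"
      by (subst finite_image_iff) (auto simp: inj_on_def infinite_Ioi)
    ultimately show "infinite {u \<in> {n. n \<le> - 1}. x - u \<in> V}"
      using finite_subset by blast
  next
    fix c :: int assume "c \<noteq> 0"
    have "{v \<in> V. v + c \<in> V} \<subseteq> {- (2 * \<bar>c\<bar>)..2 * \<bar>c\<bar>}"
    proof
      fix v assume "v \<in> {v \<in> V. v + c \<in> V}"
      then obtain i j where "\<bar>v\<bar> = 2 ^ i" "\<bar>v + c\<bar> = 2 ^ j" using power by blast
      then have "\<bar>v\<bar> \<le> 2 * \<bar>v + c - v\<bar>"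
        using \<open>c \<noteq> 0\<close> by (intro abs_le_twice_difference) auto
      then show "v \<in> {- (2 * \<bar>c\<bar>)..2 * \<bar>c\<bar>}" by auto
    qed
    then show "finite {v \<in> V. v + c \<in> V}" using finite_subset by blast
  qed
  show ?thesis using ex_co_minimal_partner by blast
qed

end
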